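(* For any integer $n$, with the convention that $\mathscr B_n$ is the empty set for $n<0$, one has $$ S^*_{-n}.1=\sum_{\mathfrak b\in \mathscr{B}_n} \left(\prod_{i=1}^{\ell(\mathfrak b)}\frac{1}{q^{-r_i(\mathfrak b)}-1}\right)q_{\mathfrak b}(x;q^{-1}), $$ where $q_{\mathfrak b}(x;q^{-1}):=q_{b_1}(x;q^{-1})q_{b_2}(x;q^{-1})\cdots$ for $\mathfrak b=(b_1,b_2,\ldots)$.
   Context: Parameter: $q$ is generic; the identity is in the ring of symmetric functions in $x_1,x_2,\ldots$ with coefficients in $\mathbb C(q)$. Let $p_r=\sum_i x_i^r$ be the power sums, so that this ring is the polynomial ring in $p_1,p_2,\ldots$. Vertex operator: the operators $S^*_n$ ($n\in\mathbb Z$) on symmetric functions are defined by $$S^*(z)=\exp\left(-\sum_{n\ge1}\frac1n p_nz^n\right)\exp\left(\sum_{n\ge1}\frac{\partial}{\partial p_n}z^{-n}\right)=\sum_{n\in\mathbb Z}S^*_nz^{-n},$$ where $p_n$ acts by multiplication. $S^*_r.1$ denotes the action of $S^*_r$ on the constant symmetric function $1$. The generalized complete symmetric functions $q_n(x;t)$ are defined by $$\exp\left(\sum_{n\ge1}\frac{1-t^n}{n}p_nz^n\right)=\sum_{n\ge0}q_n(x;t)z^n,$$ and are used here at $t=q^{-1}$. A brick tabloid of $n\ge0$ is a row of $n$ boxes tiled by consecutive bricks, i.e. an ordered sequence $\mathfrak b=(b_1,\ldots,b_k)$ of positive integers with $\sum_i b_i=n$; $\ell(\mathfrak b)=k$ is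 the number of bricks and $r_i(\mathfrak b)=b_1+\cdots+b_i$. $\mathscr B_n$ is the set of all brick tabloids of $n$; $\mathscr B_0=\{\varnothing\}$ with $\ell(\varnothing)=0$ (empty products are $1$). *)

theory Defs
  imports
    "HOL-Computational_Algebra.Computational_Algebra"
    "HOL-Library.Poly_Mapping"
begin

section \<open>The coefficient field and the ring of symmetric functions\<close>

text \<open>The field \<open>\<complex>(q)\<close>; the generic parameter \<open>q\<close> is its indeterminate.\<close>

type_synonym cq = "complex poly fract"

definition q :: cq where
  "q = to_fract [:0, 1:]"

text \<open>
  The ring of symmetric functions over \<open>\<complex>(q)\<close>, as the polynomial ring in the power sums
  \<open>p\<^sub>1, p\<^sub>2, \<dots>\<close>. A finitely supported map from exponent vectors to coefficients is a polynomial;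
  the exponent vector \<open>m\<close> stands for the monomial \<open>\<Prod>i. p\<^bsub>i+1\<^esub> ^ lookup m i\<close>. Indices
  are shifted by one so that the variables are exactly \<open>p\<^sub>1, p\<^sub>2, \<dots>\<close>; hence \<open>psum n\<close> and
  \<open>dpsum n\<close> below are meaningful for \<open>n \<ge> 1\<close> only, and are only used there.
\<close>

type_synonym sym = "(nat \<Rightarrow>\<^sub>0 nat) \<Rightarrow>\<^sub>0 cq"

definition scalar :: "cq \<Rightarrow> sym" where
  "scalar c = Poly_Mapping.single 0 c"

definition psum :: "nat \<Rightarrow> sym" where
  "psum n = Poly_Mapping.single (Poly_Mapping.single (n - 1) 1) 1"

text \<open>
  \<open>\<partial>/\<partial>p\<^sub>n\<close>, monomial by monomial. Subtraction of exponent vectors is truncated, which is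
  harmless: a monomial free of \<open>p\<^sub>n\<close> gets the coefficient \<open>0\<close>.
\<close>

definition dpsum :: "nat \<Rightarrow> sym \<Rightarrow> sym" where
  "dpsum n f = (\<Sum>m\<in>Poly_Mapping.keys f.
     Poly_Mapping.single (m - Poly_Mapping.single (n - 1) 1)
       (of_nat (Poly_Mapping.lookup m (n - 1)) * Poly_Mapping.lookup f m))"


section \<open>Exponentials\<close>

text \<open>
  \<open>exp a = (\<Sum>m. a ^ m / m!)\<close> for a formal power series \<open>a\<close> over the ring of symmetric functions
  without constant term. The library's \<open>fps_exp\<close> is not available, since its coefficients
  have to form a field.
\<close>

definition sym_exp :: "sym fps \<Rightarrow> sym fps" where
  "sym_exp a = fps_compose (Abs_fps (\<lambda>m. scalar (1 / of_nat (fact m)))) a"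

text \<open>The operator \<open>\<Sum>n\<ge>1. (\<partial>/\<partial>p\<^sub>n) w ^ n\<close>, acting on formal power series in \<open>w\<close>.\<close>

definition dpsum_series :: "sym fps \<Rightarrow> sym fps" where
  "dpsum_series F = Abs_fps (\<lambda>k. \<Sum>n=1..k. dpsum n (fps_nth F (k - n)))"

text \<open>
  The coefficient of \<open>w ^ k\<close> in \<open>exp (\<Sum>n\<ge>1. (\<partial>/\<partial>p\<^sub>n) w ^ n) f\<close>. The exponential series may be cut
  off at \<open>m = k\<close> because each application of the operator raises the order in \<open>w\<close>.
\<close>

definition exp_dpsum_coeff :: "nat \<Rightarrow> sym \<Rightarrow> sym" where
  "exp_dpsum_coeff k f =
     (\<Sum>m\<le>k. scalar (1 / of_nat (fact m)) * fps_nth ((dpsum_series ^^ m) (fps_const f)) k)"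


section \<open>The vertex operator\<close>

text \<open>
  \<open>S\<^sup>*(z) f\<close> as a Laurent series in \<open>z\<close>. The second factor is \<open>exp (\<Sum>n\<ge>1. (\<partial>/\<partial>p\<^sub>n) z\<^bsup>-n\<^esup>) f\<close>, which
  has only finitely many nonzero terms (see \<open>finite_exp_dpsum_coeff\<close> below), so that it is indeed a
  Laurent series.
\<close>

definition Sstar_series :: "sym \<Rightarrow> sym fls" where
  "Sstar_series f =
     fps_to_fls (sym_exp (Abs_fps (\<lambda>n. if n = 0 then 0 else - (scalar (1 / of_nat n) * psum n))))
     * Abs_fls (\<lambda>i. if i \<le> 0 then exp_dpsum_coeff (nat (- i)) f else 0)"

definition Sstar :: "int \<Rightarrow> sym \<Rightarrow> sym" where
  "Sstar n f = fls_nth (Sstar_series f) (- n)"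


section \<open>Generalized complete symmetric functions and brick tabloids\<close>

definition qfun :: "nat \<Rightarrow> cq \<Rightarrow> sym" where
  "qfun n t =
     fps_nth (sym_exp (Abs_fps (\<lambda>n. if n = 0 then 0 else scalar ((1 - t ^ n) / of_nat n) * psum n))) n"

definition brick_tabloids :: "int \<Rightarrow> nat list set" where
  "brick_tabloids n = {b. (\<forall>x\<in>set b. 0 < x) \<and> int (sum_list b) = n}"

definition brick_end :: "nat list \<Rightarrow> nat \<Rightarrow> nat" where
  "brick_end b i = sum_list (take i b)"

definition qfun_brick :: "nat list \<Rightarrow> cq \<Rightarrow> sym" where
  "qfun_brick b t = prod_list (map (\<lambda>n. qfun n t) b)"


section \<open>Well-definedness\<close>

lemma brick_tabloids_neg: "n < 0 \<Longrightarrow> brick_tabloids n = {}"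
  by (auto simp: brick_tabloids_def)

lemma brick_tabloids_0: "brick_tabloids 0 = {[]}"
proof -
  have "b = []" if "\<forall>x\<in>set b. 0 < x" "sum_list b = 0" for b :: "nat list"
    using that by (cases b) auto
  then show ?thesis by (auto simp: brick_tabloids_def)
qed

lemma finite_brick_tabloids: "finite (brick_tabloids n)"
proof (rule finite_subset)
  have len: "length b \<le> sum_list b" if "\<forall>x\<in>set b. 0 < x" for b :: "nat list"
    using that by (induction b) auto
  show "brick_tabloids n \<subseteq> {b. set b \<subseteq> {..nat n} \<and> length b \<le> nat n}"
    using len by (force simp: brick_tabloids_def dest: member_le_sum_list)
  show "finite {b. set b \<subseteq> {..nat n} \<and> length b \<le> nat n}"
    by (rule finite_lists_length_le) simp
qed

lemma of_nat_cq_eq_0_iff: "(of_nat n :: cq) = 0 \<longleftrightarrow> n = 0"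
proof -
  have "(of_nat n :: cq) = to_fract (of_nat n)"
    by (induction n) simp_all
  then show ?thesis by simp
qed

lemma q_power_neq_1:
  assumes "0 < r"
  shows "q powi (- int r) \<noteq> 1"
proof
  assume "q powi (- int r) = 1"
  then have "q ^ r = 1" by (simp add: power_int_minus)
  moreover have "q ^ r = to_fract (monom 1 r)"
    by (induction r) (simp_all add: q_def monom_Suc flip: to_fract_mult)
  ultimately have "to_fract (monom (1::complex) r) = to_fract 1" by simp
  then have "monom (1::complex) r = 1" by (simp only: to_fract_eq_iff)
  then have "degree (monom (1::complex) r) = 0" by simp
  with assms show False by (simp add: degree_monom_eq)
qed

lemma lookup_dpsum:
  "Poly_Mapping.lookup (dpsum n f) m =
     of_nat (Poly_Mapping.lookup m (n - 1) + 1)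
       * Poly_Mapping.lookup f (m + Poly_Mapping.single (n - 1) 1)"
proof -
  let ?e = "Poly_Mapping.single (n - 1) (1::nat)"
  have eq: "m' = m + ?e" if "m' - ?e = m" "Poly_Mapping.lookup m' (n - 1) \<noteq> 0" for m' :: "nat \<Rightarrow>\<^sub>0 nat"
  proof (rule poly_mapping_eqI)
    fix k
    show "Poly_Mapping.lookup m' k = Poly_Mapping.lookup (m + ?e) k"
      using that by (auto simp: lookup_add lookup_minus lookup_single when_def)
  qed
  have "Poly_Mapping.lookup (dpsum n f) m =
      (\<Sum>m'\<in>Poly_Mapping.keys f. if m' = m + ?e
        then of_nat (Poly_Mapping.lookup m' (n - 1)) * Poly_Mapping.lookup f m' else 0)"
    unfolding dpsum_def lookup_sum
    by (rule sum.cong) (use eq in \<open>fastforce simp: lookup_single when_def\<close>)+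
  also have "\<dots> = of_nat (Poly_Mapping.lookup m (n - 1) + 1) * Poly_Mapping.lookup f (m + ?e)"
    by (subst sum.delta) (auto simp: lookup_add lookup_single in_keys_iff)
  finally show ?thesis .
qed

text \<open>The grading in which \<open>p\<^sub>n\<close> has degree \<open>n\<close>.\<close>

definition wt :: "(nat \<Rightarrow>\<^sub>0 nat) \<Rightarrow> nat" where
  "wt m = (\<Sum>i\<in>Poly_Mapping.keys m. Suc i * Poly_Mapping.lookup m i)"

lemma wt_superset:
  "finite A \<Longrightarrow> Poly_Mapping.keys m \<subseteq> A \<Longrightarrow> wt m = (\<Sum>i\<in>A. Suc i * Poly_Mapping.lookup m i)"
  unfolding wt_def by (rule sum.mono_neutral_left) (auto simp: in_keys_iff)

lemma wt_add_single: "wt (m + Poly_Mapping.single i 1) = wt m + Suc i"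
proof -
  let ?A = "insert i (Poly_Mapping.keys m)"
  have "wt (m + Poly_Mapping.single i 1) =
      (\<Sum>j\<in>?A. Suc j * Poly_Mapping.lookup (m + Poly_Mapping.single i 1) j)"
    by (rule wt_superset) (auto simp: in_keys_iff lookup_add lookup_single when_def split: if_splits)
  also have "\<dots> = (\<Sum>j\<in>?A. Suc j * Poly_Mapping.lookup m j + (if j = i then Suc i else 0))"
    by (rule sum.cong) (auto simp: lookup_add lookup_single when_def)
  also have "\<dots> = wt m + Suc i"
    by (subst sum.distrib, subst sum.delta) (simp_all only: wt_superset[of ?A m] finite_insert
      finite_keys subset_insertI insertI1 if_True)
  finally show ?thesis .
qed

lemma lookup_scalar_mult: "Poly_Mapping.lookup (scalar c * f) m = c * Poly_Mapping.lookup f m"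
proof -
  have "scalar c * f = Poly_Mapping.map ((*) c) f"
    by (simp add: scalar_def mult_map_scale_conv_mult)
  then show ?thesis by (simp add: Poly_Mapping.map.rep_eq when_def)
qed

lemma finite_exp_dpsum_coeff: "finite {k. exp_dpsum_coeff k f \<noteq> 0}"
proof -
  define N where "N = Max (insert 0 (wt ` Poly_Mapping.keys f))"
  have N: "Poly_Mapping.lookup f m = 0" if "wt m > N" for m
    using that by (auto simp: N_def in_keys_iff not_less[symmetric])
  have *: "Poly_Mapping.lookup (fps_nth ((dpsum_series ^^ j) (fps_const f)) k) m = 0"
    if "wt m + k > N" for j k m
    using that
  proof (induction j arbitrary: k m)
    case 0
    then show ?case by (cases "k = 0") (auto simp: N)
  next
    case (Suc j)
    then show ?case
      by (auto simp: dpsum_series_def lookup_sum lookup_dpsum wt_add_single[unfolded One_nat_def]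
               intro!: sum.neutral)
  qed
  have "exp_dpsum_coeff k f = 0" if "k > N" for k
    by (rule poly_mapping_eqI)
       (use that in \<open>auto simp: exp_dpsum_coeff_def lookup_sum lookup_scalar_mult *\<close>)
  then have "{k. exp_dpsum_coeff k f \<noteq> 0} \<subseteq> {..N}"
    using not_less by auto
  then show ?thesis by (rule finite_subset) simp
qed

lemma Sstar_series_second_factor_nth:
  "fls_nth (Abs_fls (\<lambda>i. if i \<le> 0 then exp_dpsum_coeff (nat (- i)) f else 0)) i =
     (if i \<le> 0 then exp_dpsum_coeff (nat (- i)) f else 0)"
  using finite_exp_dpsum_coeff[of f]
  by (subst nth_Abs_fls) (auto simp: eventually_cofinite)

end

theory Submission
  imports Defs
begin

text \<open>
  Since the derivations \<open>\<partial>/\<partial>p\<^sub>n\<close> annihilate \<open>1\<close>, the elements \<open>a\<^sub>n = S\<^sup>*\<^bsub>-n\<^esub>.1\<close> have the generating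
  function \<open>A(z) = exp (- P(z))\<close> with \<open>P(z) = (\<Sum>n\<ge>1. p\<^sub>n z\<^sup>n / n)\<close>, whereas the \<open>q\<^sub>n(x;t)\<close> have the
  generating function \<open>exp (P(z) - P(tz))\<close>. The product of the two is \<open>A(tz)\<close>, which gives
  \<open>(t\<^sup>n - 1) a\<^sub>n = (\<Sum>k=1..n. a\<^bsub>n-k\<^esub> q\<^sub>k(x;t))\<close>. For \<open>t = q\<^sup>-\<^sup>1\<close> the sum over brick tabloids satisfies
  the same recursion, obtained by removing the last brick.
\<close>

lemma scalar_0 [simp]: "scalar 0 = 0"
  and scalar_1 [simp]: "scalar 1 = 1"
  and scalar_add: "scalar (c + d) = scalar c + scalar d"
  and scalar_diff: "scalar (c - d) = scalar c - scalar d"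
  and scalar_mult: "scalar (c * d) = scalar c * scalar d"
  by (simp_all add: scalar_def single_add single_diff mult_single single_one)

lemma scalar_power: "scalar (c ^ n) = scalar c ^ n"
  by (induction n) (simp_all add: scalar_mult)

lemma scalar_of_nat: "scalar (of_nat n) = of_nat n"
  by (induction n) (simp_all add: scalar_add)

text \<open>Reading off the coefficient at the exponent vector 0 reduces this to characteristic zero
  of \<open>cq\<close>.\<close>

lemma of_nat_sym_neq_0: "0 < n \<Longrightarrow> (of_nat n :: sym) \<noteq> 0"
  using lookup_scalar_mult[of "of_nat n" 1 0] of_nat_cq_eq_0_iff[of n]
  by (auto simp: scalar_of_nat)

lemma scalar_inverse_mult: "c \<noteq> 0 \<Longrightarrow> scalar (1 / c) * scalar c = 1"
  by (simp flip: scalar_mult)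

text \<open>The coefficient of z^m in F' = F c expresses (m+1) F_{m+1} through F_0, ..., F_m, and
  m+1 can be cancelled.\<close>

lemma fps_linear_ode_unique:
  fixes F G c :: "'a :: idom fps"
  assumes char_0: "\<And>n. 0 < n \<Longrightarrow> of_nat n \<noteq> (0 :: 'a)"
    and F: "fps_deriv F = F * c" and G: "fps_deriv G = G * c" and init: "F $ 0 = G $ 0"
  shows "F = G"
proof (rule fps_ext)
  fix n
  show "F $ n = G $ n"
  proof (induction n rule: less_induct)
    case (less n)
    show ?case
    proof (cases n)
      case 0
      with init show ?thesis by simp
    next
      case (Suc m)
      have "(F * c) $ m = (G * c) $ m"
        unfolding fps_mult_nth by (rule sum.cong) (use less Suc in auto)
      then have "fps_deriv F $ m = fps_deriv G $ m"
        by (simp only: F G)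
      then have "of_nat (Suc m) * F $ Suc m = of_nat (Suc m) * G $ Suc m"
        by (simp only: fps_deriv_nth Suc_eq_plus1)
      then show ?thesis
        using Suc char_0[of "Suc m"] by (simp del: of_nat_Suc)
    qed
  qed
qed

lemma sym_exp_nth_0 [simp]: "sym_exp a $ 0 = 1"
  by (simp add: sym_exp_def)

lemma fps_deriv_sym_exp:
  assumes "a $ 0 = 0"
  shows "fps_deriv (sym_exp a) = sym_exp a * fps_deriv a"
proof -
  let ?e = "Abs_fps (\<lambda>m. scalar (1 / of_nat (fact m)))"
  have "of_nat (Suc m) * scalar (1 / of_nat (fact (Suc m))) = scalar (1 / of_nat (fact m))" for m
  proof -
    have "of_nat (Suc m) * scalar (1 / of_nat (fact (Suc m))) =
        scalar (of_nat (Suc m) * (1 / of_nat (fact (Suc m))))"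
      by (simp only: scalar_mult scalar_of_nat)
    also have "of_nat (Suc m) * (1 / of_nat (fact (Suc m))) = (1 / of_nat (fact m) :: cq)"
      using of_nat_cq_eq_0_iff[of "Suc m"]
      by (simp only: fact_Suc of_nat_mult of_nat_id) simp
    finally show ?thesis .
  qed
  then have "fps_deriv ?e = ?e"
    by (intro fps_ext) (simp del: of_nat_Suc fact_Suc)
  with fps_compose_deriv[OF assms, of ?e] show ?thesis
    by (simp add: sym_exp_def)
qed

text \<open>Both sides have constant term 1 and solve F' = F (a + b)'.\<close>

lemma sym_exp_add:
  assumes "a $ 0 = 0" "b $ 0 = 0"
  shows "sym_exp (a + b) = sym_exp a * sym_exp b"
  by (rule fps_linear_ode_unique[where c = "fps_deriv (a + b)"])
     (use assms in \<open>simp_all add: fps_deriv_sym_exp of_nat_sym_neq_0 algebra_simps del: of_nat_Suc\<close>)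

text \<open>Replacing z by cz is composition with \<open>fps_const c * fps_X\<close>, and
  composition is associative.\<close>

lemma sym_exp_compose_linear:
  assumes "a $ 0 = 0"
  shows "sym_exp (Abs_fps (\<lambda>n. c ^ n * a $ n)) = Abs_fps (\<lambda>n. c ^ n * sym_exp a $ n)"
  using fps_compose_assoc[of "fps_const c * fps_X" a "Abs_fps (\<lambda>m. scalar (1 / of_nat (fact m)))"]
    assms
  by (simp add: sym_exp_def fps_compose_linear)

text \<open>The first factor of the vertex operator, which is all that remains when it acts on
  1.\<close>

definition sstar_gf :: "sym fps" where
  "sstar_gf = sym_exp (Abs_fps (\<lambda>n. if n = 0 then 0 else - (scalar (1 / of_nat n) * psum n)))"

lemma dpsum_1: "dpsum n 1 = 0"
proof (rule poly_mapping_eqI)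
  fix m :: "nat \<Rightarrow>\<^sub>0 nat"
  \<comment> \<open>The coefficient of \<open>dpsum n 1\<close> at \<open>m\<close> is a multiple of
    that of 1 at this exponent vector, and 1 is supported at 0 only.\<close>
  have "m + Poly_Mapping.single (n - 1) 1 \<noteq> 0"
  proof
    assume "m + Poly_Mapping.single (n - 1) 1 = 0"
    then have "Poly_Mapping.lookup (m + Poly_Mapping.single (n - 1) 1) (n - 1) = 0"
      by (simp only: lookup_zero)
    then show False by (simp add: lookup_add)
  qed
  then show "Poly_Mapping.lookup (dpsum n 1) m = Poly_Mapping.lookup 0 m"
    by (simp only: lookup_dpsum lookup_one lookup_zero when_def if_False mult_zero_right)
qed

lemma exp_dpsum_coeff_1: "exp_dpsum_coeff k 1 = (if k = 0 then 1 else 0)"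
proof -
  have dz: "dpsum_series 0 = 0"
    by (rule fps_ext) (simp add: dpsum_series_def dpsum_def)
  have d1: "dpsum_series 1 = 0"
  proof (rule fps_ext)
    fix k
    \<comment> \<open>The argument is a coefficient of the constant series 1, hence 0 or 1; both are
      annihilated.\<close>
    have "dpsum n (1 $ (k - n)) = 0" for n
      by (cases "k - n = 0") (simp_all add: dpsum_1, simp add: dpsum_def)
    then show "dpsum_series 1 $ k = 0 $ k"
      by (simp add: dpsum_series_def)
  qed
  have "(dpsum_series ^^ m) 1 = (if m = 0 then 1 else 0)" for m
    by (induction m) (auto simp: dz d1)
  then have "exp_dpsum_coeff k 1 =
      (\<Sum>m\<le>k. if m = 0 then scalar (1 / of_nat (fact 0)) * (1 :: sym fps) $ k else 0)"
    unfolding exp_dpsum_coeff_def fps_const_1_eq_1 by (intro sum.cong) auto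
  then show ?thesis by simp
qed

lemma Sstar_1: "Sstar (- n) 1 = (if n < 0 then 0 else sstar_gf $ nat n)"
proof -
  let ?G = "Abs_fls (\<lambda>i. if i \<le> 0 then exp_dpsum_coeff (nat (- i)) 1 else 0)"
  have "?G = 1"
    by (rule fls_eqI) (auto simp: Sstar_series_second_factor_nth exp_dpsum_coeff_1)
  then have "Sstar_series 1 = fps_to_fls sstar_gf"
    by (simp add: Sstar_series_def sstar_gf_def)
  then show ?thesis by (simp add: Sstar_def)
qed

lemma qfun_0: "qfun 0 t = 1"
  by (simp add: qfun_def)

text \<open>The exponents add up: -1/n + (1 - t^n)/n = -t^n/n, which is the exponent of
  \<open>sstar_gf\<close> with z replaced by tz.\<close>

lemma sstar_gf_qfun:
  "sstar_gf * Abs_fps (\<lambda>n. qfun n t) = Abs_fps (\<lambda>n. scalar (t ^ n) * sstar_gf $ n)"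
proof -
  let ?a = "Abs_fps (\<lambda>n. if n = 0 then 0 else - (scalar (1 / of_nat n) * psum n))"
  let ?b = "Abs_fps (\<lambda>n. if n = 0 then 0 else scalar ((1 - t ^ n) / of_nat n) * psum n)"
  have "?a + ?b = Abs_fps (\<lambda>n. scalar t ^ n * ?a $ n)"
    by (rule fps_ext)
       (simp add: diff_divide_distrib scalar_diff algebra_simps flip: scalar_power scalar_mult)
  moreover have "Abs_fps (\<lambda>n. qfun n t) = sym_exp ?b"
    by (rule fps_ext) (simp add: qfun_def)
  ultimately show ?thesis
    using sym_exp_add[of ?a ?b] sym_exp_compose_linear[of ?a "scalar t"]
    by (simp add: sstar_gf_def scalar_power)
qed

lemma sstar_gf_rec:
  "scalar (t ^ n - 1) * sstar_gf $ n = (\<Sum>k=1..n. sstar_gf $ (n - k) * qfun k t)"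
proof -
  have "scalar (t ^ n) * sstar_gf $ n = (Abs_fps (\<lambda>n. qfun n t) * sstar_gf) $ n"
    using sstar_gf_qfun[of t] by (simp add: mult.commute)
  also have "\<dots> = (\<Sum>k=0..n. sstar_gf $ (n - k) * qfun k t)"
    unfolding fps_mult_nth by (intro sum.cong refl) (simp add: mult.commute)
  \<comment> \<open>The term k = 0 is again a multiple of the unknown coefficient; moved to the
    left, it turns t^n into t^n - 1.\<close>
  also have "\<dots> = sstar_gf $ n + (\<Sum>k=1..n. sstar_gf $ (n - k) * qfun k t)"
    by (simp add: sum.atLeast_Suc_atMost qfun_0)
  finally show ?thesis
    by (simp add: scalar_diff algebra_simps)
qed

text \<open>The summand of the theorem with an arbitrary \<open>t\<close> for the inverse of
  \<open>q\<close>, so that all powers have natural exponents.\<close>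

definition brick_term :: "nat list \<Rightarrow> cq \<Rightarrow> sym" where
  "brick_term b t = scalar (\<Prod>i=1..length b. 1 / (t ^ brick_end b i - 1)) * qfun_brick b t"

text \<open>Appending a brick keeps the earlier brick ends and adds one, the total length.\<close>

lemma brick_term_snoc:
  "brick_term (b @ [k]) t =
     scalar (1 / (t ^ (sum_list b + k) - 1)) * (brick_term b t * qfun k t)"
proof -
  have "(\<Prod>i=1..length b. 1 / (t ^ brick_end (b @ [k]) i - 1)) =
      (\<Prod>i=1..length b. 1 / (t ^ brick_end b i - 1))"
    by (rule prod.cong) (auto simp: brick_end_def)
  moreover have "brick_end (b @ [k]) (Suc (length b)) = sum_list b + k"
    by (simp add: brick_end_def)
  ultimately have "(\<Prod>i=1..length (b @ [k]). 1 / (t ^ brick_end (b @ [k]) i - 1)) =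
      1 / (t ^ (sum_list b + k) - 1) * (\<Prod>i=1..length b. 1 / (t ^ brick_end b i - 1))"
    by simp
  moreover have "qfun_brick (b @ [k]) t = qfun_brick b t * qfun k t"
    by (simp add: qfun_brick_def)
  ultimately show ?thesis
    by (simp only: brick_term_def scalar_mult mult.assoc)
qed

lemma brick_tabloids_snoc:
  assumes "0 < n"
  shows "brick_tabloids (int n) =
    (\<lambda>(k, b). b @ [k]) ` (SIGMA k:{1..n}. brick_tabloids (int (n - k)))" (is "_ = ?R")
proof (intro equalityI subsetI)
  fix b assume b: "b \<in> brick_tabloids (int n)"
  with assms have "b \<noteq> []" by (auto simp: brick_tabloids_def)
  then obtain b' k where "b = b' @ [k]" by (metis rev_exhaust)
  with b show "b \<in> ?R"
    by (intro image_eqI[where x = "(k, b')"]) (auto simp: brick_tabloids_def)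
qed (auto simp: brick_tabloids_def)

text \<open>The last brick of any tabloid of n ends at n, so its factor is common to all
  summands.\<close>

lemma sum_brick_term_rec:
  assumes "0 < n"
  shows "(\<Sum>b\<in>brick_tabloids (int n). brick_term b t) =
    scalar (1 / (t ^ n - 1)) *
      (\<Sum>k=1..n. (\<Sum>b\<in>brick_tabloids (int (n - k)). brick_term b t) * qfun k t)"
proof -
  have "inj_on (\<lambda>(k, b). b @ [k]) A" for A :: "(nat \<times> nat list) set"
    by (auto simp: inj_on_def)
  then have "(\<Sum>b\<in>brick_tabloids (int n). brick_term b t) =
      (\<Sum>(k, b)\<in>(SIGMA k:{1..n}. brick_tabloids (int (n - k))). brick_term (b @ [k]) t)"
    by (simp add: brick_tabloids_snoc[OF assms] sum.reindex case_prod_unfold)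
  also have "\<dots> = (\<Sum>k=1..n. \<Sum>b\<in>brick_tabloids (int (n - k)). brick_term (b @ [k]) t)"
    by (rule sum.Sigma[symmetric]) (auto simp: finite_brick_tabloids)
  also have "\<dots> = (\<Sum>k=1..n. \<Sum>b\<in>brick_tabloids (int (n - k)).
      scalar (1 / (t ^ n - 1)) * (brick_term b t * qfun k t))"
  proof (intro sum.cong refl)
    fix k b
    assume "k \<in> {1..n}" "b \<in> brick_tabloids (int (n - k))"
    then have "sum_list b + k = n"
      by (simp add: brick_tabloids_def)
    then show "brick_term (b @ [k]) t = scalar (1 / (t ^ n - 1)) * (brick_term b t * qfun k t)"
      by (simp only: brick_term_snoc)
  qed
  finally show ?thesis
    by (simp add: sum_distrib_left sum_distrib_right)
qed

lemma sstar_gf_eq_sum_brick_term: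
  assumes "\<And>r. 0 < r \<Longrightarrow> t ^ r \<noteq> 1"
  shows "sstar_gf $ n = (\<Sum>b\<in>brick_tabloids (int n). brick_term b t)"
proof (induction n rule: less_induct)
  case (less n)
  show ?case
  proof (cases "n = 0")
    case True
    then show ?thesis
      by (simp add: brick_tabloids_0 brick_term_def qfun_brick_def sstar_gf_def)
  next
    case False
    then have "t ^ n - 1 \<noteq> 0" using assms[of n] by simp
    then have "sstar_gf $ n = scalar (1 / (t ^ n - 1)) * (scalar (t ^ n - 1) * sstar_gf $ n)"
      by (simp add: scalar_inverse_mult flip: mult.assoc)
    \<comment> \<open>Since k is at least 1, the induction hypothesis covers n - k.\<close>
    also have "\<dots> = scalar (1 / (t ^ n - 1)) *
        (\<Sum>k=1..n. (\<Sum>b\<in>brick_tabloids (int (n - k)). brick_term b t) * qfun k t)"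
      unfolding sstar_gf_rec using less by simp
    finally show ?thesis
      using False by (simp add: sum_brick_term_rec)
  qed
qed

theorem lemma3p1:
  fixes n :: int
  shows "Sstar (- n) 1 =
    (\<Sum>b\<in>brick_tabloids n.
       scalar (\<Prod>i=1..length b. 1 / (q powi (- int (brick_end b i)) - 1))
       * qfun_brick b (inverse q))"
proof (cases "n < 0")
  case True
  then show ?thesis by (simp add: Sstar_1 brick_tabloids_neg)
next
  case False
  have powi: "q powi (- int r) = inverse q ^ r" for r
    by (simp add: power_int_minus power_inverse)
  \<comment> \<open>Here the genericity of \<open>q\<close> enters: no denominator vanishes.\<close>
  have "inverse q ^ r \<noteq> 1" if "0 < r" for r
    using q_power_neq_1[OF that] by (simp only: powi not_False_eq_True)
  from sstar_gf_eq_sum_brick_term[OF this, of "nat n"] False show ?thesis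
    by (simp add: Sstar_1 brick_term_def powi)
qed

end
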